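(* Let $G=(V,E)$ be a connected graph with $V=\{1,\dots,N\}$, $E\subset\{(n,m)\in V\times V: n<m\}$, $M=|E|$, let $w\in\mathbb{R}^N$ and $\lambda\in\mathbb{R}^M$ have positive entries, and let $\boldsymbol y=(\boldsymbol y_n)_{n\in V}\in(\mathbb{S}_1)^N$. Consider the two convex problems $$\text{(A)}\quad \operatorname*{arg\,min}_{\boldsymbol x\in(\mathbb{R}^2)^N,\ \boldsymbol r\in(\mathbb{R}^2)^M}\ \mathcal J(\boldsymbol x,\boldsymbol r)\quad\text{s.t.}\quad \boldsymbol P_{(n,m)}\succeq 0\ \text{ for all }(n,m)\in E,$$ $$\text{(B)}\quad \operatorname*{arg\,min}_{\boldsymbol x\in(\mathbb{R}^2)^N,\ \boldsymbol \ell\in\mathbb{R}^M}\ \mathcal K(\boldsymbol x,\boldsymbol \ell)\quad\text{s.t.}\quad \boldsymbol Q_{(n,m)}\succeq 0\ \text{ for all }(n,m)\in E,$$ where $\mathcal J,\mathcal K,\boldsymbol P_{(n,m)},\boldsymbol Q_{(n,m)}$ are as defined in the context. These problems are equivalent in the following sense: (i) If $(\hat{\boldsymbol x},\hat{\boldsymbol r})$ solves (A), then $(\hat{\boldsymbol x},\operatorname{Re}[\hat{\boldsymbol r}])$ solves (B), where $\operatorname{Re}[\hat{\boldsymbol r}]=(\operatorname{Re}[\hat{\boldsymbol r}_{(n,m)}])_{(n,m)\in E}$. (ii) If $(\tilde{\boldsymbol x},\tilde{\boldsymbol \ell})$ solves (B), then $(\tilde{\boldsymbol x},\tilde{\boldsymbol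 r})$ with $\tilde{\boldsymbol r}_{(n,m)}=\bigl(\tilde{\boldsymbol \ell}_{(n,m)},\ \operatorname{Im}[\boldsymbol M(\tilde{\boldsymbol x}_m)^{\mathrm T}\tilde{\boldsymbol x}_n]\bigr)^{\mathrm T}$ for all $(n,m)\in E$ solves (A).
   Context: "Solves" means "is a minimizer of". $\mathbb{S}_1=\{\boldsymbol z\in\mathbb{R}^2:\|\boldsymbol z\|=1\}$ with the Euclidean norm; $\langle\cdot,\cdot\rangle$ is the Euclidean inner product; $\boldsymbol A\succeq0$ means (symmetric) positive semi-definite; $\boldsymbol I_2$ is the $2\times2$ identity. For $\boldsymbol z\in\mathbb{R}^2$ write $\operatorname{Re}[\boldsymbol z]$ and $\operatorname{Im}[\boldsymbol z]$ for its first and second component, and $$\boldsymbol M(\boldsymbol z)=\begin{bmatrix}\operatorname{Re}[\boldsymbol z]&-\operatorname{Im}[\boldsymbol z]\\ \operatorname{Im}[\boldsymbol z]&\operatorname{Re}[\boldsymbol z]\end{bmatrix}.$$ The objectives are $$\mathcal J(\boldsymbol x,\boldsymbol r)=-\sum_{n\in V}w_n\langle\boldsymbol x_n,\boldsymbol y_n\rangle-\sum_{(n,m)\in E}\lambda_{(n,m)}\operatorname{Re}[\boldsymbol r_{(n,m)}],$$ $$\mathcal K(\boldsymbol x,\boldsymbol\ell)=-\sum_{n\in V}w_n\langle\boldsymbol x_n,\boldsymbol y_n\rangle-\sum_{(n,m)\in E}\lambda_{(n,m)}\boldsymbol\ell_{(n,m)},$$ and the matrices are $$\boldsymbol P_{(n,m)}=\begin{bmatrix}\boldsymbol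 I_2&\boldsymbol M(\boldsymbol x_n)&\boldsymbol M(\boldsymbol x_m)\\ \boldsymbol M(\boldsymbol x_n)^{\mathrm T}&\boldsymbol I_2&\boldsymbol M(\boldsymbol r_{(n,m)})^{\mathrm T}\\ \boldsymbol M(\boldsymbol x_m)^{\mathrm T}&\boldsymbol M(\boldsymbol r_{(n,m)})&\boldsymbol I_2\end{bmatrix}\in\mathbb{R}^{6\times6},\qquad \boldsymbol Q_{(n,m)}=\begin{bmatrix}\boldsymbol I_2&\boldsymbol x_n&\boldsymbol x_m\\ \boldsymbol x_n^{\mathrm T}&1&\boldsymbol\ell_{(n,m)}\\ \boldsymbol x_m^{\mathrm T}&\boldsymbol\ell_{(n,m)}&1\end{bmatrix}\in\mathbb{R}^{4\times4}.$$ *)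

theory Defs
  imports "Graph_Theory.Digraph_Component" "HOL-Analysis.Analysis"
begin

definition pos_semidef :: "real^'n^'n \<Rightarrow> bool" where
  "pos_semidef A \<longleftrightarrow> transpose A = A \<and> (\<forall>v. 0 \<le> v \<bullet> (A *v v))"

text \<open>A 3-by-3 block matrix, given row by row; rows and columns are indexed by sum types,
  so that for instance \<^typ>\<open>2 + 2 + 2\<close> indexes the six coordinates of a vector in three
  blocks of length two.\<close>

definition block3 ::
  "real^'a^'a \<Rightarrow> real^'b^'a \<Rightarrow> real^'c^'a \<Rightarrow>
   real^'a^'b \<Rightarrow> real^'b^'b \<Rightarrow> real^'c^'b \<Rightarrow>
   real^'a^'c \<Rightarrow> real^'b^'c \<Rightarrow> real^'c^'c \<Rightarrow> real^('a + 'b + 'c)^('a + 'b + 'c)" where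
  "block3 A11 A12 A13 A21 A22 A23 A31 A32 A33 = (\<chi> i j.
     (case i of
        Inl i \<Rightarrow>
          (case j of Inl j \<Rightarrow> A11 $ i $ j | Inr (Inl j) \<Rightarrow> A12 $ i $ j | Inr (Inr j) \<Rightarrow> A13 $ i $ j)
      | Inr (Inl i) \<Rightarrow>
          (case j of Inl j \<Rightarrow> A21 $ i $ j | Inr (Inl j) \<Rightarrow> A22 $ i $ j | Inr (Inr j) \<Rightarrow> A23 $ i $ j)
      | Inr (Inr i) \<Rightarrow>
          (case j of Inl j \<Rightarrow> A31 $ i $ j | Inr (Inl j) \<Rightarrow> A32 $ i $ j | Inr (Inr j) \<Rightarrow> A33 $ i $ j)))"

text \<open>Vectors of \<^typ>\<open>real^2\<close> play the role of complex numbers: component 1 is the real part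
  and component 2 the imaginary part.\<close>

definition rot_mat :: "real^2 \<Rightarrow> real^2^2" where
  "rot_mat z = vector [vector [z $ 1, - (z $ 2)],
                       vector [z $ 2, z $ 1]]"

definition P_mat :: "real^2 \<Rightarrow> real^2 \<Rightarrow> real^2 \<Rightarrow> real^(2 + 2 + 2)^(2 + 2 + 2)" where
  "P_mat xn xm r = block3
     (mat 1)                  (rot_mat xn)  (rot_mat xm)
     (transpose (rot_mat xn)) (mat 1)       (transpose (rot_mat r))
     (transpose (rot_mat xm)) (rot_mat r)   (mat 1)"

definition Q_mat :: "real^2 \<Rightarrow> real^2 \<Rightarrow> real \<Rightarrow> real^(2 + 1 + 1)^(2 + 1 + 1)" where
  "Q_mat xn xm l = block3
     (mat 1)        (columnvector xn)  (columnvector xm)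
     (rowvector xn) (mat 1)            (mat l)
     (rowvector xm) (mat l)            (mat 1)"

definition J_obj ::
  "nat set \<Rightarrow> (nat \<times> nat) set \<Rightarrow> (nat \<Rightarrow> real) \<Rightarrow> (nat \<times> nat \<Rightarrow> real) \<Rightarrow> (nat \<Rightarrow> real^2) \<Rightarrow>
   (nat \<Rightarrow> real^2) \<times> (nat \<times> nat \<Rightarrow> real^2) \<Rightarrow> real" where
  "J_obj V E w lam y = (\<lambda>(x, r).
     - (\<Sum>n\<in>V. w n * (x n \<bullet> y n)) - (\<Sum>e\<in>E. lam e * r e $ 1))"

definition K_obj ::
  "nat set \<Rightarrow> (nat \<times> nat) set \<Rightarrow> (nat \<Rightarrow> real) \<Rightarrow> (nat \<times> nat \<Rightarrow> real) \<Rightarrow> (nat \<Rightarrow> real^2) \<Rightarrow>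
   (nat \<Rightarrow> real^2) \<times> (nat \<times> nat \<Rightarrow> real) \<Rightarrow> real" where
  "K_obj V E w lam y = (\<lambda>(x, l).
     - (\<Sum>n\<in>V. w n * (x n \<bullet> y n)) - (\<Sum>e\<in>E. lam e * l e))"

text \<open>A family indexed by \<open>V\<close> or \<open>E\<close> is a function that is \<^term>\<open>undefined\<close> outside the
  index set, so that the candidates form exactly the product spaces over \<open>V\<close> and \<open>E\<close>.\<close>

definition feasible_A ::
  "nat set \<Rightarrow> (nat \<times> nat) set \<Rightarrow> (nat \<Rightarrow> real^2) \<times> (nat \<times> nat \<Rightarrow> real^2) \<Rightarrow> bool" where
  "feasible_A V E = (\<lambda>(x, r). x \<in> V \<rightarrow>\<^sub>E UNIV \<and> r \<in> E \<rightarrow>\<^sub>E UNIV \<and>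
     (\<forall>(n, m)\<in>E. pos_semidef (P_mat (x n) (x m) (r (n, m)))))"

definition feasible_B ::
  "nat set \<Rightarrow> (nat \<times> nat) set \<Rightarrow> (nat \<Rightarrow> real^2) \<times> (nat \<times> nat \<Rightarrow> real) \<Rightarrow> bool" where
  "feasible_B V E = (\<lambda>(x, l). x \<in> V \<rightarrow>\<^sub>E UNIV \<and> l \<in> E \<rightarrow>\<^sub>E UNIV \<and>
     (\<forall>(n, m)\<in>E. pos_semidef (Q_mat (x n) (x m) (l (n, m)))))"

definition solves_A ::
  "nat set \<Rightarrow> (nat \<times> nat) set \<Rightarrow> (nat \<Rightarrow> real) \<Rightarrow> (nat \<times> nat \<Rightarrow> real) \<Rightarrow> (nat \<Rightarrow> real^2) \<Rightarrow>
   (nat \<Rightarrow> real^2) \<times> (nat \<times> nat \<Rightarrow> real^2) \<Rightarrow> bool" where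
  "solves_A V E w lam y = is_arg_min (J_obj V E w lam y) (feasible_A V E)"

definition solves_B ::
  "nat set \<Rightarrow> (nat \<times> nat) set \<Rightarrow> (nat \<Rightarrow> real) \<Rightarrow> (nat \<times> nat \<Rightarrow> real) \<Rightarrow> (nat \<Rightarrow> real^2) \<Rightarrow>
   (nat \<Rightarrow> real^2) \<times> (nat \<times> nat \<Rightarrow> real) \<Rightarrow> bool" where
  "solves_B V E w lam y = is_arg_min (K_obj V E w lam y) (feasible_B V E)"

end

theory Submission
  imports Defs
begin

text \<open>The two problems have the same objective under \<open>l = Re r\<close>, so it suffices to map feasible
  points to feasible points. The quadratic form of \<open>Q\<close> is that of \<open>P\<close> restricted to vectors whose
  second and third blocks are real. Conversely, for the prescribed imaginary part of \<open>r\<close> the number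
  \<open>r - x\<^sub>n * cnj x\<^sub>m\<close> is real, so that completing the square in the first block splits the form of
  \<open>P\<close> into a square plus the form of \<open>Q\<close> at the real and at the imaginary coordinates.\<close>

definition join3 :: "real^'a \<Rightarrow> real^'b \<Rightarrow> real^'c \<Rightarrow> real^('a + 'b + 'c)" where
  "join3 a b c = (\<chi> i. case i of Inl i \<Rightarrow> a $ i | Inr (Inl i) \<Rightarrow> b $ i | Inr (Inr i) \<Rightarrow> c $ i)"

text \<open>A vector over the sum index is the join of its three restrictions, so semidefiniteness
  can be tested on three independent blocks.\<close>

lemma forall_join3: "(\<forall>v. P v) \<longleftrightarrow> (\<forall>a b c. P (join3 a b c))"
proof -
  have "v = join3 (\<chi> i. v $ Inl i) (\<chi> i. v $ Inr (Inl i)) (\<chi> i. v $ Inr (Inr i))" for v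
    by (simp add: join3_def vec_eq_iff split: sum.split)
  then show ?thesis by metis
qed

lemma sum_UNIV_Plus:
  fixes f :: "'a::finite + 'b::finite \<Rightarrow> 'c::comm_monoid_add"
  shows "(\<Sum>i\<in>UNIV. f i) = (\<Sum>i\<in>UNIV. f (Inl i)) + (\<Sum>i\<in>UNIV. f (Inr i))"
  by (simp add: UNIV_Plus_UNIV[symmetric] sum.Plus del: UNIV_Plus_UNIV)

lemma join3_inner_join3:
  "join3 a b c \<bullet> join3 a' b' c' = a \<bullet> a' + b \<bullet> b' + c \<bullet> c'"
  by (simp add: inner_vec_def sum_UNIV_Plus join3_def)

lemma block3_mult_join3:
  "block3 A11 A12 A13 A21 A22 A23 A31 A32 A33 *v join3 a b c =
    join3 (A11 *v a + A12 *v b + A13 *v c)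
          (A21 *v a + A22 *v b + A23 *v c)
          (A31 *v a + A32 *v b + A33 *v c)"
  by (simp add: vec_eq_iff join3_def block3_def matrix_vector_mult_def sum_UNIV_Plus
      split: sum.split)

lemma transpose_block3:
  "transpose (block3 A11 A12 A13 A21 A22 A23 A31 A32 A33) =
    block3 (transpose A11) (transpose A21) (transpose A31)
           (transpose A12) (transpose A22) (transpose A32)
           (transpose A13) (transpose A23) (transpose A33)"
  by (simp add: vec_eq_iff block3_def transpose_def split: sum.split)

lemma inner_transpose_mult: "y \<bullet> (transpose A *v x) = x \<bullet> (A *v y)" for A :: "real^'n^'m"
  by (metis dot_lmul_matrix inner_commute transpose_matrix_vector)

text \<open>Each lower block is the transpose of its mirror image and contributes the same scalar,
  hence the factors 2. Symmetry of the matrix then follows from that of the diagonal blocks.\<close>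

lemma pos_semidef_block3:
  assumes "transpose A = A" "transpose D = D" "transpose F = F"
  shows "pos_semidef (block3 A B C (transpose B) D G (transpose C) (transpose G) F) \<longleftrightarrow>
    (\<forall>a b c. 0 \<le> a \<bullet> (A *v a) + b \<bullet> (D *v b) + c \<bullet> (F *v c)
      + 2 * (a \<bullet> (B *v b)) + 2 * (a \<bullet> (C *v c)) + 2 * (b \<bullet> (G *v c)))"
    (is "pos_semidef ?X \<longleftrightarrow> (\<forall>a b c. 0 \<le> ?q a b c)")
proof -
  have "join3 a b c \<bullet> (?X *v join3 a b c) = ?q a b c" for a b c
    by (simp add: block3_mult_join3 join3_inner_join3 inner_add_right inner_transpose_mult
        del: transpose_matrix_vector)
  moreover have "transpose ?X = ?X"
    by (simp add: transpose_block3 assms)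
  ultimately have "pos_semidef ?X \<longleftrightarrow> (\<forall>v. 0 \<le> v \<bullet> (?X *v v))"
    and "\<And>a b c. join3 a b c \<bullet> (?X *v join3 a b c) = ?q a b c"
    unfolding pos_semidef_def by simp_all
  then show ?thesis
    unfolding forall_join3 by simp
qed

text \<open>The upper cross block of \<open>P_mat\<close> is \<open>transpose (rot_mat r)\<close>,
  so moving it across the inner product puts \<open>c\<close> on the left and \<open>b\<close> on
  the right.\<close>

lemma pos_semidef_P_mat:
  "pos_semidef (P_mat x z r) \<longleftrightarrow>
    (\<forall>a b c. 0 \<le> a \<bullet> a + b \<bullet> b + c \<bullet> c
      + 2 * (a \<bullet> (rot_mat x *v b)) + 2 * (a \<bullet> (rot_mat z *v c)) + 2 * (c \<bullet> (rot_mat r *v b)))"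
  using pos_semidef_block3[of "mat 1" "mat 1" "mat 1" "rot_mat x" "rot_mat z"
      "transpose (rot_mat r)"]
  by (simp add: P_mat_def inner_transpose_mult del: transpose_matrix_vector)

lemma forall_vec1: "(\<forall>v :: real^1. P v) \<longleftrightarrow> (\<forall>t. P (vec t))"
proof -
  have "v = vec (v $ 1)" for v :: "real^1"
    by (simp add: vec_eq_iff forall_1)
  then show ?thesis by metis
qed

lemma mat_mult_vec1: "(mat s :: real^1^1) *v vec t = vec (s * t)"
  by (simp add: vec_eq_iff matrix_vector_mult_def mat_def)

lemma columnvector_mult_vec1: "columnvector x *v (vec t :: real^1) = t *\<^sub>R x"
  by (simp add: vec_eq_iff matrix_vector_mult_def columnvector_def)

lemma pos_semidef_Q_mat:
  "pos_semidef (Q_mat x z l) \<longleftrightarrow>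
    (\<forall>a s t. 0 \<le> a \<bullet> a + s\<^sup>2 + t\<^sup>2 + 2 * s * (a \<bullet> x) + 2 * t * (a \<bullet> z) + 2 * l * s * t)"
proof -
  have Q: "Q_mat x z l = block3 (mat 1) (columnvector x) (columnvector z)
      (transpose (columnvector x)) (mat 1) (mat l)
      (transpose (columnvector z)) (transpose (mat l)) (mat 1)"
    by (simp add: Q_mat_def transpose_mat transpose_columnvector)
  show ?thesis
    unfolding Q
    by (subst pos_semidef_block3)
      (simp_all add: forall_vec1 transpose_mat mat_mult_vec1 columnvector_mult_vec1
        inner_vec_def[where 'b = 1] power2_eq_square mult_ac)
qed

text \<open>This is the complex product of \<open>z\<close> and \<open>v\<close>; in coordinates,
  the later identities become polynomial ones.\<close>

lemma rot_mat_mult: "rot_mat z *v v = vector [z$1 * v$1 - z$2 * v$2, z$2 * v$1 + z$1 * v$2]"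
  by (simp add: vec_eq_iff forall_2 rot_mat_def matrix_vector_mult_def sum_2)

lemma Q_mat_if_P_mat:
  assumes "pos_semidef (P_mat x z r)"
  shows "pos_semidef (Q_mat x z (r $ 1))"
  unfolding pos_semidef_Q_mat
proof (intro allI)
  fix a s t
  show "0 \<le> a \<bullet> a + s\<^sup>2 + t\<^sup>2 + 2 * s * (a \<bullet> x) + 2 * t * (a \<bullet> z) + 2 * r $ 1 * s * t"
    \<comment> \<open>On the real vector \<open>vector [s, 0]\<close>, \<open>rot_mat x\<close>
      gives \<open>s\<close> times \<open>x\<close>, and the cross term reduces to
      \<open>t * r $ 1 * s\<close>: the imaginary part of \<open>r\<close> drops out.\<close>
    using assms[unfolded pos_semidef_P_mat, rule_format, of a "vector [s, 0]" "vector [t, 0]"]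
    by (simp add: rot_mat_mult inner_vec_def sum_2 algebra_simps power2_eq_square)
qed

lemma P_mat_if_Q_mat:
  assumes "pos_semidef (Q_mat x z l)"
  shows "pos_semidef (P_mat x z (vector [l, (transpose (rot_mat z) *v x) $ 2]))"
  unfolding pos_semidef_P_mat
proof (intro allI)
  fix a b c :: "real^2"
  define r :: "real^2" where "r = vector [l, (transpose (rot_mat z) *v x) $ 2]"
  \<comment> \<open>\<open>transpose (rot_mat z)\<close> is multiplication by \<open>cnj z\<close>,
    so \<open>r $ 2\<close> is the imaginary part of \<open>x * cnj z\<close>.\<close>
  have r: "r $ 1 = l" "r $ 2 = x$2 * z$1 - x$1 * z$2"
    by (simp_all add: r_def matrix_vector_mult_def sum_2 transpose_def rot_mat_def)
  let ?q = "\<lambda>a s t. a \<bullet> a + s\<^sup>2 + t\<^sup>2 + 2 * s * (a \<bullet> x) + 2 * t * (a \<bullet> z) + 2 * l * s * t"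
  let ?u = "a + rot_mat x *v b + rot_mat z *v c"
  have q: "0 \<le> ?q a s t" for a s t
    using assms by (simp add: pos_semidef_Q_mat)
  \<comment> \<open>For fixed \<open>s\<close> and \<open>t\<close>, the form \<open>?q\<close> is
    minimal at \<open>a = - (s x + t z)\<close>, with value
    \<open>s^2 + t^2 + 2 l s t - |s x + t z|^2\<close>.\<close>
  have "0 \<le> ?u \<bullet> ?u + ?q (- b$1 *\<^sub>R x - c$1 *\<^sub>R z) (b$1) (c$1)
      + ?q (- b$2 *\<^sub>R x - c$2 *\<^sub>R z) (b$2) (c$2)"
    by (intro add_nonneg_nonneg[OF add_nonneg_nonneg] q inner_ge_zero)
  \<comment> \<open>Since \<open>r - x * cnj z\<close> is the real number
    \<open>l - x \<bullet> z\<close>, the part of the form of \<open>P\<close> coupling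
    \<open>b\<close> and \<open>c\<close> outside \<open>?u \<bullet> ?u\<close> is
    \<open>2 * (l - x \<bullet> z) * (b \<bullet> c)\<close>, which does not mix the two
    coordinates.\<close>
  also have "\<dots> = a \<bullet> a + b \<bullet> b + c \<bullet> c
      + 2 * (a \<bullet> (rot_mat x *v b)) + 2 * (a \<bullet> (rot_mat z *v c)) + 2 * (c \<bullet> (rot_mat r *v b))"
    by (simp add: rot_mat_mult inner_vec_def sum_2 r power2_eq_square algebra_simps)
  finally show "0 \<le> a \<bullet> a + b \<bullet> b + c \<bullet> c + 2 * (a \<bullet> (rot_mat x *v b))
      + 2 * (a \<bullet> (rot_mat z *v c))
      + 2 * (c \<bullet> (rot_mat (vector [l, (transpose (rot_mat z) *v x) $ 2]) *v b))"
    by (simp add: r_def)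
qed

text \<open>Any competitor \<open>q\<close> satisfies \<open>g q = f (h q) \<ge> f p = g p'\<close>.
  Only values are compared, so \<open>h p'\<close> may differ from \<open>p\<close>; this matters
  because passing from (A) to (B) forgets the imaginary part of \<open>r\<close>.\<close>

lemma is_arg_min_transfer:
  fixes f :: "'a \<Rightarrow> 'c::linorder"
  assumes "is_arg_min f P p" and "Q p'" and "g p' = f p"
    and "\<And>q. Q q \<Longrightarrow> P (h q) \<and> f (h q) = g q"
  shows "is_arg_min g Q p'"
proof -
  have "f p \<le> f (h q)" if "Q q" for q
    using assms(1) assms(4)[OF that] by (auto simp: is_arg_min_linorder)
  with assms(2-4) show ?thesis
    by (simp add: is_arg_min_linorder)
qed

text \<open>Restricting to \<open>E\<close> makes the family \<open>undefined\<close> off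
  \<open>E\<close>, as membership in the product space requires.\<close>

definition to_B ::
  "(nat \<times> nat) set \<Rightarrow> (nat \<Rightarrow> real^2) \<times> (nat \<times> nat \<Rightarrow> real^2) \<Rightarrow>
   (nat \<Rightarrow> real^2) \<times> (nat \<times> nat \<Rightarrow> real)" where
  "to_B E = (\<lambda>(x, r). (x, \<lambda>e\<in>E. r e $ 1))"

definition to_A ::
  "(nat \<times> nat) set \<Rightarrow> (nat \<Rightarrow> real^2) \<times> (nat \<times> nat \<Rightarrow> real) \<Rightarrow>
   (nat \<Rightarrow> real^2) \<times> (nat \<times> nat \<Rightarrow> real^2)" where
  "to_A E = (\<lambda>(x, l).
     (x, \<lambda>(n, m)\<in>E. vector [l (n, m), (transpose (rot_mat (x m)) *v x n) $ 2]))"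

lemma feasible_to_B: "feasible_A V E p \<Longrightarrow> feasible_B V E (to_B E p)"
  by (cases p) (auto simp: feasible_A_def feasible_B_def to_B_def intro!: Q_mat_if_P_mat
      simp del: transpose_matrix_vector)

lemma feasible_to_A: "feasible_B V E p \<Longrightarrow> feasible_A V E (to_A E p)"
  by (cases p) (auto simp: feasible_A_def feasible_B_def to_A_def intro!: P_mat_if_Q_mat
      simp del: transpose_matrix_vector)

lemma K_obj_to_B: "K_obj V E w lam y (to_B E p) = J_obj V E w lam y p"
  by (auto simp: J_obj_def K_obj_def to_B_def split: prod.split intro!: sum.cong)

lemma J_obj_to_A: "J_obj V E w lam y (to_A E p) = K_obj V E w lam y p"
  by (auto simp: J_obj_def K_obj_def to_A_def split: prod.split intro!: sum.cong)

lemma solves_B_to_B: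
  assumes "solves_A V E w lam y p"
  shows "solves_B V E w lam y (to_B E p)"
proof -
  have "feasible_A V E p"
    using assms by (simp add: solves_A_def is_arg_min_def)
  then show ?thesis
    \<comment> \<open>\<open>to_B\<close> produces the candidate, while \<open>to_A\<close> pulls
      its competitors back to (A).\<close>
    using is_arg_min_transfer[OF assms[unfolded solves_A_def], where h = "to_A E"]
    by (simp add: solves_B_def feasible_to_A feasible_to_B K_obj_to_B J_obj_to_A)
qed

lemma solves_A_to_A:
  assumes "solves_B V E w lam y p"
  shows "solves_A V E w lam y (to_A E p)"
proof -
  have "feasible_B V E p"
    using assms by (simp add: solves_B_def is_arg_min_def)
  then show ?thesis
    using is_arg_min_transfer[OF assms[unfolded solves_B_def], where h = "to_B E"]
    by (simp add: solves_A_def feasible_to_A feasible_to_B K_obj_to_B J_obj_to_A)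
qed

theorem theorem5:
  fixes N :: nat and V :: "nat set" and E :: "(nat \<times> nat) set"
    and w :: "nat \<Rightarrow> real" and lam :: "nat \<times> nat \<Rightarrow> real" and y :: "nat \<Rightarrow> real^2"
  assumes "V = {1..N}"
    and "E \<subseteq> {(n, m) \<in> V \<times> V. n < m}"
    and "Digraph_Component.connected (with_proj \<lparr>pverts = V, parcs = E\<rparr>)"
    and "\<forall>n\<in>V. 0 < w n"
    and "\<forall>e\<in>E. 0 < lam e"
    and "\<forall>n\<in>V. y n \<in> sphere 0 1"
  shows "(\<forall>x r. solves_A V E w lam y (x, r) \<longrightarrow>
            solves_B V E w lam y (x, \<lambda>e\<in>E. r e $ 1)) \<and>
         (\<forall>x l. solves_B V E w lam y (x, l) \<longrightarrow>
            solves_A V E w lam y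
              (x, \<lambda>(n, m)\<in>E. vector [l (n, m), (transpose (rot_mat (x m)) *v x n) $ 2]))"
proof (intro conjI allI impI)
  fix x r
  assume "solves_A V E w lam y (x, r)"
  from solves_B_to_B[OF this] show "solves_B V E w lam y (x, \<lambda>e\<in>E. r e $ 1)"
    by (simp add: to_B_def)
next
  fix x l
  assume "solves_B V E w lam y (x, l)"
  from solves_A_to_A[OF this] show "solves_A V E w lam y
      (x, \<lambda>(n, m)\<in>E. vector [l (n, m), (transpose (rot_mat (x m)) *v x n) $ 2])"
    by (simp add: to_A_def)
qed

end
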